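(* Let $\mathrm{L}$ be an $n \times n$ matrix with entries in $\mathbb{F}_2$ of the form $$\mathrm{L} = \begin{bmatrix} p_{n-1} & 1 & 0 & 0 & \cdots & 0 \\ p_{n-2} & 0 & 1 & 0 & \cdots & 0 \\ p_{n-3} & 0 & 0 & 1 & \cdots & 0 \\ \vdots & \vdots & \vdots & \vdots & \ddots & \vdots \\ p_1 & 0 & 0 & 0 & \cdots & 1 \\ p_0 & 0 & 0 & 0 & \cdots & 0 \end{bmatrix},$$ i.e. the first column is $(p_{n-1}, p_{n-2}, \dots, p_1, p_0)^T$ with $p_0, \dots, p_{n-1} \in \mathbb{F}_2$, the entry in position $(i,i+1)$ is $1$ for $1 \le i \le n-1$, and all other entries are $0$. Let $\chi(x)$ be the characteristic polynomial of $\mathrm{L}$, and let $\tau$ be the $n \times n$ reflection matrix, whose $(i,j)$ entry is $1$ if $i+j=n+1$ and $0$ otherwise. Then $\mathrm{L}$ satisfies $\mathrm{L} = \tau \cdot \mathrm{L}^n \cdot \tau$ if and only if $\chi(x) = \sum_{j=0}^{n} x^j$.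
   Context: The matrix $\mathrm{L}$ describes the state change $\mathrm{w} \mapsto \mathrm{w} \cdot \mathrm{L}$ of an $n$-bit Fibonacci linear feedback shift register, where $\mathrm{w} = [s_{n-1}\, s_{n-2} \cdots s_1\, s_0]$ is the row of register bits. The characteristic polynomial of $\mathrm{L}$ over $\mathbb{F}_2$ is $\chi(x) = x^n + p_{n-1}x^{n-1} + \cdots + p_1 x + p_0$.
   Formalization: The formal theorem assumes n ≥ 2: for n = 1 and p_0 = 0 the matrix L = [0] satisfies L = τ·L·τ although χ(x) = x is not x + 1, so the equivalence fails there. *)

theory Defs
  imports "Jordan_Normal_Form.Char_Poly" "HOL-Library.Z2"
begin

text \<open>
  The field with two elements is the type \<open>bit\<close>.  Matrix indices are zero-based, so the
  one-based position \<open>(i + 1, j + 1)\<close> of the usual notation is \<open>(i, j)\<close> here; in particular the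
  entry of the first column in one-based row \<open>i + 1\<close> is \<open>p\<^bsub>n - 1 - i\<^esub>\<close>.
  Only the values \<open>p 0, \<dots>, p (n - 1)\<close> matter.
\<close>

definition lfsr_mat :: "nat \<Rightarrow> (nat \<Rightarrow> bit) \<Rightarrow> bit mat" where
  "lfsr_mat n p = mat n n (\<lambda>(i, j).
     if j = 0 then p (n - 1 - i) else if j = i + 1 then 1 else 0)"

text \<open>The one-based condition \<open>i + j = n + 1\<close> becomes \<open>i + j + 1 = n\<close>.\<close>

definition reflection_mat :: "nat \<Rightarrow> bit mat" where
  "reflection_mat n = mat n n (\<lambda>(i, j). if i + j + 1 = n then 1 else 0)"

end

theory Submission imports Defs
begin

text \<open>
  Acting on columns, \<open>L\<close> shifts the unit vectors, \<open>e\<^bsub>j+1\<^esub> \<mapsto> e\<^bsub>j\<^esub>\<close>, and sends \<open>e\<^bsub>0\<^esub>\<close> to its own first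
  column \<open>c\<close>.  Hence column \<open>n - 1 - j\<close> of \<open>L\<^sup>n\<close> is \<open>L\<^sup>j c\<close>, and \<open>L = \<tau> L\<^sup>n \<tau>\<close> says that column \<open>j\<close>
  of \<open>L\<close>, read backwards, is \<open>L\<^sup>j c\<close> for every \<open>j\<close>.  For \<open>j = 1\<close> this reads \<open>L c = e\<^bsub>n-1\<^esub>\<close>, which
  already forces all entries of \<open>c\<close> to be \<open>1\<close>; conversely, if they are all \<open>1\<close>, then
  \<open>L c = e\<^bsub>n-1\<^esub>\<close>, and shifting gives the remaining columns.
\<close>

lemma lfsr_mat_carrier [simp]: "lfsr_mat n p \<in> carrier_mat n n"
  by (simp add: lfsr_mat_def)

text \<open>Row and column \<open>i\<close> of the reflection are both the unit vector with index
  \<open>n - 1 - i\<close>, so each factor just reverses one index.\<close>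

lemma mult_reflection_mat_conj:
  assumes "A \<in> carrier_mat n n"
  shows "reflection_mat n * A * reflection_mat n = mat n n (\<lambda>(i, j). A $$ (n - 1 - i, n - 1 - j))"
proof -
  have row: "row (reflection_mat n) i = unit_vec n (n - 1 - i)"
    and col: "col (reflection_mat n) i = unit_vec n (n - 1 - i)" if "i < n" for i
    using that by (auto simp: reflection_mat_def intro!: eq_vecI)
  have left: "reflection_mat n * A = mat n n (\<lambda>(i, j). A $$ (n - 1 - i, j))"
  proof (rule eq_matI)
    fix i j assume "i < dim_row (mat n n (\<lambda>(i, j). A $$ (n - 1 - i, j)))"
      and "j < dim_col (mat n n (\<lambda>(i, j). A $$ (n - 1 - i, j)))"
    with assms show "(reflection_mat n * A) $$ (i, j) = mat n n (\<lambda>(i, j). A $$ (n - 1 - i, j)) $$ (i, j)"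
      by (simp add: row scalar_prod_left_unit reflection_mat_def[THEN arg_cong[of _ _ dim_row]])
  qed (use assms in \<open>simp_all add: reflection_mat_def\<close>)
  show ?thesis
    unfolding left
    by (rule eq_matI) (simp_all add: col scalar_prod_right_unit
        reflection_mat_def[THEN arg_cong[of _ _ dim_col]])
qed

lemma mult_mat_vec_unit_index:
  fixes A :: "'a :: comm_semiring_1 mat"
  assumes "A \<in> carrier_mat m n" "i < m" "j < n"
  shows "(A *\<^sub>v unit_vec n j) $ i = A $$ (i, j)"
  using assms by (simp add: row_def)

lemma pow_mat_Suc_mult_vec:
  fixes A :: "'a :: comm_semiring_1 mat"
  assumes "A \<in> carrier_mat n n" "v \<in> carrier_vec n"
  shows "A ^\<^sub>m Suc k *\<^sub>v v = A ^\<^sub>m k *\<^sub>v (A *\<^sub>v v)"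
  using assms by (simp add: assoc_mult_mat_vec[of _ n n _ n])

lemma lfsr_mat_mult_vec_index:
  assumes "v \<in> carrier_vec n" "i < n"
  shows "(lfsr_mat n p *\<^sub>v v) $ i = p (n - 1 - i) * v $ 0 + (if Suc i < n then v $ Suc i else 0)"
proof -
  have row: "row (lfsr_mat n p) i
      = p (n - 1 - i) \<cdot>\<^sub>v unit_vec n 0 + (if Suc i < n then unit_vec n (Suc i) else 0\<^sub>v n)"
  proof (rule eq_vecI)
    fix j assume "j < dim_vec (p (n - 1 - i) \<cdot>\<^sub>v unit_vec n 0
      + (if Suc i < n then unit_vec n (Suc i) else 0\<^sub>v n))"
    then have "j < n"
      by (simp split: if_splits)
    with assms show "row (lfsr_mat n p) i $ j = (p (n - 1 - i) \<cdot>\<^sub>v unit_vec n 0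
      + (if Suc i < n then unit_vec n (Suc i) else 0\<^sub>v n)) $ j"
      by (cases "Suc i < n"; cases "j = 0"; cases "j = Suc i") (simp_all add: lfsr_mat_def)
  qed (simp add: lfsr_mat_def)
  have "(lfsr_mat n p *\<^sub>v v) $ i = row (lfsr_mat n p) i \<bullet> v"
    using assms by (intro index_mult_mat_vec) (simp add: lfsr_mat_def)
  also have "\<dots> = p (n - 1 - i) * v $ 0 + (if Suc i < n then v $ Suc i else 0)"
    using assms unfolding row by (subst add_scalar_prod_distrib[of _ n]) (simp_all add: scalar_prod_left_unit)
  finally show ?thesis .
qed

lemma lfsr_mat_mult_unit_Suc:
  assumes "Suc j < n"
  shows "lfsr_mat n p *\<^sub>v unit_vec n (Suc j) = unit_vec n j"
proof (rule eq_vecI)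
  fix i assume "i < dim_vec (unit_vec n j :: bit vec)"
  with assms show "(lfsr_mat n p *\<^sub>v unit_vec n (Suc j)) $ i = unit_vec n j $ i"
    by (simp add: lfsr_mat_mult_vec_index del: index_mult_mat_vec)
qed (simp add: lfsr_mat_def)

text \<open>Each of \<open>k\<close> factors lowers the index of the unit vector by one. The spare
  exponent \<open>m\<close> keeps the factors left over once index 0 is reached.\<close>

lemma lfsr_mat_pow_mult_unit:
  assumes "i + k < n"
  shows "lfsr_mat n p ^\<^sub>m (m + k) *\<^sub>v unit_vec n (i + k) = lfsr_mat n p ^\<^sub>m m *\<^sub>v unit_vec n i"
  using assms
proof (induction k)
  case (Suc k)
  then show ?case
    using pow_mat_Suc_mult_vec[of "lfsr_mat n p" n "unit_vec n (Suc (i + k))" "m + k"]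
    by (simp add: lfsr_mat_mult_unit_Suc)
qed simp

lemma lfsr_mat_pow_index:
  assumes "i < n" "j < n"
  shows "(lfsr_mat n p ^\<^sub>m n) $$ (i, n - 1 - j) = (lfsr_mat n p ^\<^sub>m j *\<^sub>v (lfsr_mat n p *\<^sub>v unit_vec n 0)) $ i"
proof -
  have "(lfsr_mat n p ^\<^sub>m n) $$ (i, n - 1 - j) = (lfsr_mat n p ^\<^sub>m n *\<^sub>v unit_vec n (n - 1 - j)) $ i"
    using assms by (subst mult_mat_vec_unit_index[of _ n n]) auto
  \<comment> \<open>Of the \<open>n\<close> factors, \<open>n - 1 - j\<close> are spent on moving
    the unit vector down to index 0, which leaves \<open>Suc j\<close>.\<close>
  also have "lfsr_mat n p ^\<^sub>m n *\<^sub>v unit_vec n (n - 1 - j) = lfsr_mat n p ^\<^sub>m Suc j *\<^sub>v unit_vec n 0"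
    using assms lfsr_mat_pow_mult_unit[of 0 "n - 1 - j" n p "Suc j"] by simp
  also have "\<dots> = lfsr_mat n p ^\<^sub>m j *\<^sub>v (lfsr_mat n p *\<^sub>v unit_vec n 0)"
    by (rule pow_mat_Suc_mult_vec[of _ n]) auto
  finally show ?thesis .
qed

text \<open>The bound on \<open>n\<close> makes column 1 exist. For \<open>n = 1\<close> the matrix
  equation holds for every \<open>p\<close>, so the equivalence would fail.\<close>

lemma lfsr_mat_eq_conj_pow_iff_ones:
  assumes "n \<ge> 2"
  shows "lfsr_mat n p = reflection_mat n * lfsr_mat n p ^\<^sub>m n * reflection_mat n \<longleftrightarrow> (\<forall>k<n. p k = 1)"
    (is "?L = ?R \<longleftrightarrow> _")
proof -
  define c where "c = ?L *\<^sub>v unit_vec n 0"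
  have c_carrier: "c \<in> carrier_vec n"
    unfolding c_def by (rule mult_mat_vec_carrier[of _ n n]) auto
  have c_index: "c $ i = p (n - 1 - i)" if "i < n" for i
    using that by (simp add: c_def lfsr_mat_mult_vec_index del: index_mult_mat_vec)
  have Lc_index: "(?L *\<^sub>v c) $ i
      = p (n - 1 - i) * p (n - 1) + (if Suc i < n then p (n - 1 - Suc i) else 0)" if "i < n" for i
    using that c_carrier assms by (simp add: lfsr_mat_mult_vec_index c_index del: index_mult_mat_vec)
  have R_index: "?R $$ (i, j) = (?L ^\<^sub>m j *\<^sub>v c) $ (n - 1 - i)" if "i < n" "j < n" for i j
    using that lfsr_mat_pow_index[of "n - 1 - i" n j p]
    by (simp add: mult_reflection_mat_conj[of _ n] c_def)
  show ?thesis
  proof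
    assume eq: "?L = ?R"
    have Lc: "(?L *\<^sub>v c) $ i = (if i = n - 1 then 1 else 0)" if "i < n" for i
    proof -
      have "(?L *\<^sub>v c) $ i = ?R $$ (n - 1 - i, 1)"
        using that assms c_carrier
        by (subst R_index) (auto simp: left_mult_one_mat[of _ n n])
      also have "\<dots> = ?L $$ (n - 1 - i, 1)"
        using eq by simp
      finally show ?thesis
        using that assms by (auto simp: lfsr_mat_def)
    qed
    \<comment> \<open>The last entry of \<open>L c\<close> is \<open>p 0 * p (n - 1)\<close>, and a
      product equal to 1 over two elements has both factors 1.\<close>
    have "p (n - 1) = 1"
      using Lc[of "n - 1"] Lc_index[of "n - 1"] assms by (cases "p (n - 1)") auto
    \<comment> \<open>Entry \<open>n - 2 - k\<close> of \<open>L c\<close> is not the last one, so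
      it vanishes; in characteristic 2 a zero sum means equal summands.\<close>
    have step: "p (k + 1) = p k" if "Suc k < n" for k
    proof -
      have "n - 2 - k < n - 1" "n - 1 - (n - 2 - k) = k + 1" "n - 1 - Suc (n - 2 - k) = k"
        using that by auto
      then have "p (k + 1) + p k = 0"
        using Lc[of "n - 2 - k"] Lc_index[of "n - 2 - k"] \<open>p (n - 1) = 1\<close> by simp
      then show ?thesis
        by (cases "p k"; cases "p (k + 1)") auto
    qed
    show "\<forall>k<n. p k = 1"
    proof (intro allI impI)
      fix k assume "k < n"
      then have "k \<le> n - 1"
        by simp
      then show "p k = 1"
        using \<open>p (n - 1) = 1\<close> by (induction rule: inc_induct) (simp_all add: step[simplified, symmetric])
    qed
  next
    assume ones: "\<forall>k<n. p k = 1"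
    \<comment> \<open>Every entry but the last is 1 + 1 = 0.\<close>
    have Lc: "?L *\<^sub>v c = unit_vec n (n - 1)"
    proof (rule eq_vecI)
      fix i assume "i < dim_vec (unit_vec n (n - 1) :: bit vec)"
      with ones assms show "(?L *\<^sub>v c) $ i = unit_vec n (n - 1) $ i"
        by (simp add: Lc_index del: index_mult_mat_vec) auto
    qed (simp add: lfsr_mat_def)
    show "?L = ?R"
    proof (rule eq_matI)
      fix i j assume "i < dim_row ?R" "j < dim_col ?R"
      then have ij: "i < n" "j < n"
        by (simp_all add: reflection_mat_def)
      show "?L $$ (i, j) = ?R $$ (i, j)"
      proof (cases j)
        case 0
        then show ?thesis
          using ij ones c_carrier unfolding R_index[OF ij]
          by (simp add: c_index lfsr_mat_def)
      next
        case (Suc k)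
        have "?L ^\<^sub>m j *\<^sub>v c = ?L ^\<^sub>m k *\<^sub>v unit_vec n (n - 1)"
          using pow_mat_Suc_mult_vec[of ?L n c k] c_carrier by (simp add: Suc Lc)
        \<comment> \<open>The \<open>k = j - 1\<close> remaining factors shift index
          \<open>n - 1\<close> down to \<open>n - j\<close>; reversed, this is index
          \<open>j - 1\<close>, where column \<open>j\<close> of \<open>L\<close> has its 1.\<close>
        also have "\<dots> = unit_vec n (n - j)"
          using lfsr_mat_pow_mult_unit[of "n - j" k n p 0] ij Suc
          by (simp add: carrier_matD(1)[OF lfsr_mat_carrier])
        finally show ?thesis
          using ij Suc unfolding R_index[OF ij] by (auto simp: lfsr_mat_def)
      qed
    qed (simp_all add: lfsr_mat_def reflection_mat_def)
  qed
qed

text \<open>Laplace expansion along the last row, which can be nonzero only in its first and last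
  entries. The last cofactor is the same problem in size \<open>n\<close>, with coefficients shifted
  to \<open>p \<circ> Suc\<close>, hence the arbitrary \<open>p\<close>.\<close>

lemma char_poly_lfsr_mat:
  "char_poly (lfsr_mat n p) = monom 1 n + (\<Sum>k<n. monom (p k) k)"
proof (induction n arbitrary: p)
  case 0
  show ?case
    by (simp add: char_poly_def char_poly_matrix_def lfsr_mat_def)
next
  case (Suc n)
  define C where "C = char_poly_matrix (lfsr_mat (Suc n) p)"
  have C: "C \<in> carrier_mat (Suc n) (Suc n)"
    by (simp add: C_def)
  have C_index: "C $$ (i, j) = (if i = j then [:0, 1:] else 0)
      + [:if j = 0 then p (n - i) else if j = i + 1 then 1 else 0:]" if "i \<le> n" "j \<le> n" for i j
    using that by (auto simp: C_def char_poly_matrix_def lfsr_mat_def)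
  have "mat_delete C n n = char_poly_matrix (lfsr_mat n (p \<circ> Suc))"
    using C
    by (intro eq_matI)
      (auto simp: mat_delete_def C_index char_poly_matrix_def lfsr_mat_def Suc_diff_Suc)
  then have corner: "cofactor C n n = monom 1 n + (\<Sum>k<n. monom (p (Suc k)) k)"
    using Suc.IH[of "p \<circ> Suc"] by (simp add: cofactor_def char_poly_def del: o_apply) simp
  \<comment> \<open>Without the first column, the superdiagonal of ones becomes the diagonal and
    nothing is left above it.\<close>
  have triangular: "det (mat_delete C n 0) = 1"
  proof -
    have carrier: "mat_delete C n 0 \<in> carrier_mat n n"
      using mat_delete_carrier[OF C] by simp
    have "mat_delete C n 0 $$ (i, j) = 0" if "i < j" "j < n" for i j
      using that C by (simp add: mat_delete_def C_index)
    moreover have "diag_mat (mat_delete C n 0) = map (\<lambda>_. 1) [0..<n]"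
      using C by (auto simp: diag_mat_def mat_delete_def C_index one_pCons)
    ultimately show ?thesis
      using det_lower_triangular[OF _ carrier] by (simp add: map_replicate_const)
  qed
  have "(- 1 :: bit poly) = 1"
    by (simp add: one_pCons)
  then have "cofactor C n 0 = 1"
    by (simp only: cofactor_def triangular power_one mult_1)
  have "char_poly (lfsr_mat (Suc n) p) = det C"
    by (simp add: char_poly_def C_def)
  also have "\<dots> = (\<Sum>j<Suc n. C $$ (n, j) * cofactor C n j)"
    using laplace_expansion_row[OF C] by blast
  \<comment> \<open>Two separate conditionals, added, also cover \<open>n = 0\<close>, where the
    first and last columns coincide.\<close>
  also have "\<dots> = (\<Sum>j<Suc n. (if j = n then [:0, 1:] * cofactor C n n else 0)
      + (if j = 0 then [:p 0:] * cofactor C n 0 else 0))"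
    by (intro sum.cong) (auto simp: C_index algebra_simps)
  also have "\<dots> = [:0, 1:] * cofactor C n n + [:p 0:] * cofactor C n 0"
    by (subst sum.distrib) (simp)
  also have "\<dots> = monom 1 (Suc n) + (\<Sum>k<Suc n. monom (p k) k)"
    unfolding corner \<open>cofactor C n 0 = 1\<close> sum.lessThan_Suc_shift
    by (simp add: distrib_left sum_distrib_left monom_Suc monom_0 add_ac)
  finally show ?case .
qed

text \<open>The leading terms cancel, and the coefficients below degree \<open>n\<close> are
  compared one by one.\<close>

lemma char_poly_lfsr_mat_eq_ones_iff:
  "char_poly (lfsr_mat n p) = (\<Sum>j = 0..n. monom 1 j) \<longleftrightarrow> (\<forall>k<n. p k = 1)"
proof -
  have "{0..n} = insert n {..<n}"
    by auto
  then have "char_poly (lfsr_mat n p) = (\<Sum>j = 0..n. monom 1 j)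
      \<longleftrightarrow> (\<Sum>k<n. monom (p k) k) = (\<Sum>k<n. monom 1 k)"
    by (simp add: char_poly_lfsr_mat)
  also have "\<dots> \<longleftrightarrow> (\<forall>k<n. p k = 1)"
  proof
    assume eq: "(\<Sum>k<n. monom (p k) k) = (\<Sum>k<n. monom 1 k)"
    show "\<forall>k<n. p k = 1"
    proof (intro allI impI)
      fix k assume "k < n"
      with arg_cong[OF eq, of "\<lambda>q. coeff q k"] show "p k = 1"
        by (simp add: coeff_sum)
    qed
  qed simp
  finally show ?thesis .
qed

theorem theorem1p1:
  fixes n :: nat and p :: "nat \<Rightarrow> bit" and L \<tau> :: "bit mat"
  assumes "n \<ge> 2"
    and "L = lfsr_mat n p"
    and "\<tau> = reflection_mat n"
  shows "L = \<tau> * L ^\<^sub>m n * \<tau> \<longleftrightarrow> char_poly L = (\<Sum>j = 0..n. monom 1 j)"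
  using assms lfsr_mat_eq_conj_pow_iff_ones char_poly_lfsr_mat_eq_ones_iff by simp

end
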